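(* Let $(\mathrm{W}, \preceq, v)$ be a partially ordered abelian semigroup with order-unit. Let $\mathrm{W}_1$ be a subsemigroup of $\mathrm{W}$ containing $v$, and let $\varphi$ be a state of $(\mathrm{W}_1, \preceq, v)$. Let $a\in \mathrm{W}$. Set $$p=\sup\{(\varphi(b)-\varphi(c))/m \mid b, c\in \mathrm{W}_1, m\in \mathbb{N}, b\preceq c+ma\},$$ and $$q=\inf\{(\varphi(b)-\varphi(c))/m \mid b, c\in \mathrm{W}_1, m\in \mathbb{N}, b\succeq c+ma\}.$$ Then $-\infty<p\le q<\infty$, and $$[p, q]=\{\psi(a) \mid \psi \text{ is a state of } (\mathrm{W}, \preceq, v) \text{ extending } \varphi\}.$$ In particular, every state of $(\mathrm{W}_1, \preceq, v)$ extends to a state of $(\mathrm{W}, \preceq, v)$.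
   Context: $\mathbb{N}=\{1,2,\dots\}$. A partially ordered abelian semigroup $(\mathrm{W},\preceq)$ is an abelian semigroup (not necessarily with identity) with a partial order such that $a\preceq b$ implies $a+c\preceq b+c$ for all $c$. An element $v\in\mathrm{W}$ is an order-unit if for every $a\in\mathrm{W}$ there is some $n\in\mathbb{N}$ with $a\preceq a+v$, $a\preceq nv$, and $v\preceq a+nv$. A state of $(\mathrm{W},\preceq,v)$ is a semigroup homomorphism $\varphi:\mathrm{W}\to\mathbb{R}$ (into the additive group) with $\varphi(v)=1$ and $\varphi(a)\le\varphi(b)$ whenever $a\preceq b$. A subsemigroup is given the restricted order. *)

theory Defs
  imports "HOL-Library.Extended_Real"
begin

text \<open>
  A partially ordered abelian semigroup is a type of class
  \<^class>\<open>ordered_ab_semigroup_add\<close>; no neutral element is assumed.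
\<close>

text \<open>
  The multiple \<open>n a = a + \<dots> + a\<close> (\<open>n\<close> summands) is meaningful only for \<open>n \<ge> 1\<close>, since
  there need not be a neutral element. All uses below are guarded by \<open>n \<ge> 1\<close>.
\<close>

definition multiple :: "nat \<Rightarrow> 'a::ab_semigroup_add \<Rightarrow> 'a" where
  "multiple n a = (((+) a) ^^ (n - 1)) a"

lemma multiple_1 [simp]: "multiple 1 a = a"
  by (simp add: multiple_def)

lemma multiple_Suc: "n \<ge> 1 \<Longrightarrow> multiple (Suc n) a = a + multiple n a"
  by (cases n) (simp_all add: multiple_def)

definition order_unit :: "'a::ordered_ab_semigroup_add \<Rightarrow> bool" where
  "order_unit v \<longleftrightarrow>
     (\<forall>a. \<exists>n\<ge>1. a \<le> a + v \<and> a \<le> multiple n v \<and> v \<le> a + multiple n v)"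

definition subsemigroup :: "'a::ab_semigroup_add set \<Rightarrow> bool" where
  "subsemigroup S \<longleftrightarrow> (\<forall>x\<in>S. \<forall>y\<in>S. x + y \<in> S)"

text \<open>
  States of \<open>(S, \<le>, v)\<close> for a subsemigroup \<open>S\<close> containing \<open>v\<close>, with the restricted order.
  The values of \<open>f\<close> outside \<open>S\<close> are irrelevant; \<open>S = UNIV\<close> gives the states of the
  whole semigroup.
\<close>

definition state_on :: "'a::ordered_ab_semigroup_add set \<Rightarrow> 'a \<Rightarrow> ('a \<Rightarrow> real) \<Rightarrow> bool" where
  "state_on S v f \<longleftrightarrow>
     (\<forall>x\<in>S. \<forall>y\<in>S. f (x + y) = f x + f y) \<and>
     f v = 1 \<and>
     (\<forall>x\<in>S. \<forall>y\<in>S. x \<le> y \<longrightarrow> f x \<le> f y)"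

definition extends_on :: "'a set \<Rightarrow> ('a \<Rightarrow> real) \<Rightarrow> ('a \<Rightarrow> real) \<Rightarrow> bool" where
  "extends_on S f g \<longleftrightarrow> (\<forall>x\<in>S. g x = f x)"

end

theory Submission
  imports Defs
begin

text \<open>
  A value \<open>t\<close> can be assigned to \<open>a\<close> as soon as it satisfies the inequalities defining \<open>[p, q]\<close>:
  if \<open>c + m a \<le> c' + n a\<close> with, say, \<open>m < n\<close>, then \<open>k c + m a \<le> k c' + k (n - m) a + m a\<close> for all
  \<open>k\<close>, and the order-unit absorbs the common term \<open>m a\<close> up to an error that does not depend on \<open>k\<close>.
  Dividing by \<open>k\<close> gives \<open>\<phi> c + m t \<le> \<phi> c' + n t\<close>, which is what is needed to extend \<open>\<phi>\<close> to the
  elements that \<open>W\<^sub>1\<close> and \<open>a\<close> generate. Zorn's lemma does the rest.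
\<close>

section \<open>Multiples without a neutral element, and cancellation up to the order-unit\<close>

lemma multiple_Suc_0 [simp]: "multiple (Suc 0) x = x"
  by (simp add: multiple_def)

lemma multiple_add:
  assumes "m \<ge> 1" "n \<ge> 1"
  shows "multiple (m + n) x = multiple m x + multiple n x"
  using assms by (induction m rule: nat_induct_at_least) (simp_all add: multiple_Suc add.assoc)

lemma multiple_plus_distrib:
  "m \<ge> 1 \<Longrightarrow> multiple m (x + y) = multiple m x + multiple m y"
  by (induction m rule: nat_induct_at_least) (simp_all add: multiple_Suc ac_simps)

lemma multiple_multiple:
  assumes "m \<ge> 1" "n \<ge> 1"
  shows "multiple m (multiple n x) = multiple (m * n) x"
  using assms(1)
proof (induction m rule: nat_induct_at_least)
  case base
  show ?case by simp
next
  case (Suc m)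
  then have "multiple (Suc m * n) x = multiple n x + multiple (m * n) x"
    using multiple_add[of n "m * n" x] assms(2) by simp
  with Suc show ?case by (simp add: multiple_Suc)
qed

lemma multiple_mono:
  fixes x y :: "'a::ordered_ab_semigroup_add"
  assumes "m \<ge> 1" "x \<le> y"
  shows "multiple m x \<le> multiple m y"
  using assms by (induction m rule: nat_induct_at_least) (simp_all add: multiple_Suc add_mono)

text \<open>Iterating \<open>u + x \<le> w + x\<close> needs only one copy of \<open>x\<close>,
  handed on from each step to the next. So \<open>x\<close> is exchanged for multiples of
  \<open>v\<close> just once, by \<open>v \<le> x + n v\<close> on the left and
  \<open>x \<le> n v\<close> on the right, and \<open>N = 2 n\<close> does not depend on
  \<open>k\<close>.\<close>

lemma multiple_cancel_upto_order_unit: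
  fixes u w x v :: "'a::ordered_ab_semigroup_add"
  assumes "order_unit v" and le: "u + x \<le> w + x"
  obtains N where "N \<ge> 1" "\<And>k. k \<ge> 1 \<Longrightarrow> multiple k u + v \<le> multiple k w + multiple N v"
proof -
  obtain n where n: "n \<ge> 1" "x \<le> multiple n v" "v \<le> x + multiple n v"
    using assms(1) unfolding order_unit_def by blast
  have "multiple k u + v \<le> multiple k w + multiple (n + n) v" if "k \<ge> 1" for k
  proof -
    have iter: "multiple k u + x \<le> multiple k w + x"
      using that
    proof (induction k rule: nat_induct_at_least)
      case base
      show ?case using le by simp
    next
      case (Suc k)
      have "multiple (Suc k) u + x = u + (multiple k u + x)"
        using Suc.hyps by (simp add: multiple_Suc add.assoc)
      also have "\<dots> \<le> u + (multiple k w + x)" using Suc.IH by (rule add_left_mono)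
      also have "\<dots> = multiple k w + (u + x)" by (simp add: ac_simps)
      also have "\<dots> \<le> multiple k w + (w + x)" using le by (rule add_left_mono)
      also have "\<dots> = multiple (Suc k) w + x"
        using Suc.hyps by (simp add: multiple_Suc ac_simps)
      finally show ?case .
    qed
    have "multiple k u + v \<le> multiple k u + (x + multiple n v)"
      using n(3) by (rule add_left_mono)
    also have "\<dots> = (multiple k u + x) + multiple n v" by (simp add: add.assoc)
    also have "\<dots> \<le> (multiple k w + x) + multiple n v" using iter by (rule add_right_mono)
    also have "\<dots> \<le> (multiple k w + multiple n v) + multiple n v"
      using n(2) by (intro add_right_mono add_left_mono)
    also have "\<dots> = multiple k w + multiple (n + n) v"
      using n(1) by (simp add: multiple_add add.assoc)
    finally show ?thesis .
  qed
  then show ?thesis using that[of "n + n"] n(1) by simp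
qed

lemma nonpos_if_multiples_bounded:
  fixes A C :: real
  assumes "\<And>k::nat. k \<ge> 1 \<Longrightarrow> real k * A \<le> C"
  shows "A \<le> 0"
proof (rule ccontr)
  assume "\<not> A \<le> 0"
  then obtain n where "C < real n * A" using reals_Archimedean3[of A] by auto
  \<comment> \<open>The Archimedean \<open>n\<close> may be 0, whereas the bound is assumed only
    from 1 on; hence \<open>Suc n\<close>.\<close>
  moreover have "real n * A \<le> real (Suc n) * A"
    using \<open>\<not> A \<le> 0\<close> by (intro mult_right_mono) auto
  ultimately show False using assms[of "Suc n"] by simp
qed

section \<open>Partial states as graphs\<close>

text \<open>
  Partial states are represented by their graphs; monotonicity makes the relation single-valued.
\<close>

definition state_graph :: "('a::ordered_ab_semigroup_add \<times> real) set \<Rightarrow> bool" where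
  "state_graph G \<longleftrightarrow>
     (\<forall>x r y s. (x, r) \<in> G \<longrightarrow> (y, s) \<in> G \<longrightarrow> (x + y, r + s) \<in> G \<and> (x \<le> y \<longrightarrow> r \<le> s))"

lemma state_graph_add:
  "state_graph G \<Longrightarrow> (x, r) \<in> G \<Longrightarrow> (y, s) \<in> G \<Longrightarrow> (x + y, r + s) \<in> G"
  unfolding state_graph_def by blast

lemma state_graph_mono:
  "state_graph G \<Longrightarrow> (x, r) \<in> G \<Longrightarrow> (y, s) \<in> G \<Longrightarrow> x \<le> y \<Longrightarrow> r \<le> s"
  unfolding state_graph_def by blast

lemma state_graph_multiple:
  assumes "state_graph G" "(x, r) \<in> G" "m \<ge> 1"
  shows "(multiple m x, real m * r) \<in> G"
  using assms(3)
proof (induction m rule: nat_induct_at_least)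
  case base
  show ?case using assms(2) by simp
next
  case (Suc m)
  then show ?case
    using state_graph_add[OF assms(1,2) Suc.IH] by (simp add: multiple_Suc algebra_simps)
qed

lemma state_graph_of_state_on:
  assumes "subsemigroup S" "state_on S v f"
  shows "state_graph {(x, f x) | x. x \<in> S}"
  using assms unfolding state_graph_def subsemigroup_def state_on_def by auto

section \<open>Admissible values at a new element\<close>

text \<open>For the graph of \<open>\<phi>\<close> on \<open>W\<^sub>1\<close> this is
  \<open>p \<le> t \<le> q\<close>. Quantified inequalities in place of \<open>Sup\<close> and
  \<open>Inf\<close> keep extended reals out of the extension argument.\<close>

definition admissible :: "('a::ordered_ab_semigroup_add \<times> real) set \<Rightarrow> 'a \<Rightarrow> real \<Rightarrow> bool" where
  "admissible G a t \<longleftrightarrow>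
     (\<forall>b r c s m. (b, r) \<in> G \<longrightarrow> (c, s) \<in> G \<longrightarrow> m \<ge> 1 \<longrightarrow>
        (b \<le> c + multiple m a \<longrightarrow> (r - s) / real m \<le> t) \<and>
        (c + multiple m a \<le> b \<longrightarrow> t \<le> (r - s) / real m))"

lemma admissible_lower:
  assumes "admissible G a t" "(b, r) \<in> G" "(c, s) \<in> G" "m \<ge> 1" "b \<le> c + multiple m a"
  shows "r - s \<le> real m * t"
proof -
  have "(r - s) / real m \<le> t" using assms unfolding admissible_def by blast
  then show ?thesis using assms(4) by (simp add: divide_le_eq mult.commute)
qed

lemma admissible_upper:
  assumes "admissible G a t" "(b, r) \<in> G" "(c, s) \<in> G" "m \<ge> 1" "c + multiple m a \<le> b"
  shows "real m * t \<le> r - s"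
proof -
  have "t \<le> (r - s) / real m" using assms unfolding admissible_def by blast
  then show ?thesis using assms(4) by (simp add: le_divide_eq mult.commute)
qed

lemma admissible_iff_state_on:
  "admissible {(x, f x) | x. x \<in> S} a t \<longleftrightarrow>
     (\<forall>b c m. b \<in> S \<longrightarrow> c \<in> S \<longrightarrow> m \<ge> 1 \<longrightarrow>
        (b \<le> c + multiple m a \<longrightarrow> (f b - f c) / real m \<le> t) \<and>
        (c + multiple m a \<le> b \<longrightarrow> t \<le> (f b - f c) / real m))"
  unfolding admissible_def by auto

text \<open>Necessity: \<open>H\<close> gives \<open>c + m a\<close> the value
  \<open>s + m t\<close>, and comparing this element with \<open>b\<close> inside \<open>H\<close>
  yields the inequalities.\<close>

lemma admissible_if_state_graph:
  assumes "state_graph H" "G \<subseteq> H" "(a, t) \<in> H"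
  shows "admissible G a t"
proof -
  have "(b \<le> c + multiple m a \<longrightarrow> (r - s) / real m \<le> t) \<and>
        (c + multiple m a \<le> b \<longrightarrow> t \<le> (r - s) / real m)"
    if "(b, r) \<in> G" "(c, s) \<in> G" "m \<ge> 1" for b r c s m
  proof -
    have "(b, r) \<in> H" "(c, s) \<in> H" using that assms(2) by auto
    moreover have "(c + multiple m a, s + real m * t) \<in> H"
      using assms \<open>(c, s) \<in> H\<close> \<open>m \<ge> 1\<close> by (intro state_graph_add state_graph_multiple)
    ultimately have "b \<le> c + multiple m a \<longrightarrow> r \<le> s + real m * t"
      "c + multiple m a \<le> b \<longrightarrow> s + real m * t \<le> r"
      using state_graph_mono[OF assms(1)] by blast+
    then show ?thesis using \<open>m \<ge> 1\<close> by (simp add: divide_le_eq le_divide_eq algebra_simps)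
  qed
  then show ?thesis unfolding admissible_def by blast
qed

text \<open>Every lower bound lies below every upper bound, so the real supremum of the lower bounds
  is admissible. The order-unit makes both sets of bounds nonempty.\<close>

lemma admissible_exists:
  fixes v a :: "'a::ordered_ab_semigroup_add"
  assumes v: "order_unit v" "(v, 1) \<in> G" and G: "state_graph G"
  shows "\<exists>t. admissible G a t"
proof -
  let ?L = "{(r - s) / real m | r s m b c.
    (b, r) \<in> G \<and> (c, s) \<in> G \<and> m \<ge> 1 \<and> b \<le> c + multiple m a}"
  let ?U = "{(r - s) / real m | r s m b c.
    (b, r) \<in> G \<and> (c, s) \<in> G \<and> m \<ge> 1 \<and> c + multiple m a \<le> b}"
  obtain n where n: "n \<ge> 1" "a \<le> multiple n v" "v \<le> a + multiple n v"
    using v(1) unfolding order_unit_def by blast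
  have nv: "(multiple n v, real n * 1) \<in> G" using G v(2) n(1) by (rule state_graph_multiple)
  have "v \<le> multiple n v + multiple 1 a" using n(3) by (simp only: multiple_1 add.commute)
  then have L: "?L \<noteq> {}" using v(2) nv by blast
  \<comment> \<open>With no zero to serve as \<open>c\<close>, the bound \<open>a \<le> n v\<close>
    is shifted by \<open>v\<close> to obtain the form \<open>c + m a \<le> b\<close>.\<close>
  have "v + multiple 1 a \<le> v + multiple n v" using n(2) by (simp only: multiple_1 add_left_mono)
  then have U: "?U \<noteq> {}" using v(2) state_graph_add[OF G v(2) nv] by blast
  have LU: "l \<le> u" if L: "l \<in> ?L" and U: "u \<in> ?U" for l u
  proof -
    obtain b r c s m where l: "l = (r - s) / real m" "(b, r) \<in> G" "(c, s) \<in> G" "m \<ge> 1"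
      "b \<le> c + multiple m a" using L by blast
    obtain b' r' c' s' m' where u: "u = (r' - s') / real m'" "(b', r') \<in> G" "(c', s') \<in> G"
      "m' \<ge> 1" "c' + multiple m' a \<le> b'" using U by blast
    \<comment> \<open>Scaling the two inequalities by \<open>m'\<close> and \<open>m\<close> makes
      \<open>m m' a\<close> occur in both; it is then passed from one to the other, so nothing has
      to be cancelled.\<close>
    have "multiple m' b + multiple m c' \<le> multiple m' (c + multiple m a) + multiple m c'"
      using l u by (intro add_right_mono multiple_mono)
    also have "\<dots> = multiple m' c + multiple m (c' + multiple m' a)"
      using l(4) u(4) by (simp add: multiple_plus_distrib multiple_multiple ac_simps)
    also have "\<dots> \<le> multiple m' c + multiple m b'"
      using l u by (intro add_left_mono multiple_mono)
    finally have "real m' * r + real m * s' \<le> real m' * s + real m * r'"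
      by (rule state_graph_mono[OF G, rotated 2])
        (use l u in \<open>auto intro!: state_graph_add state_graph_multiple G\<close>)
    then show ?thesis unfolding l(1) u(1) using l(4) u(4) by (simp add: field_simps)
  qed
  then have bdd: "bdd_above ?L" using U by (meson bdd_above.I ex_in_conv)
  have "l \<le> Sup ?L" if "l \<in> ?L" for l using that bdd by (rule cSup_upper)
  moreover have "Sup ?L \<le> u" if "u \<in> ?U" for u using L LU[OF _ that] by (rule cSup_least)
  ultimately obtain t where t: "\<And>l. l \<in> ?L \<Longrightarrow> l \<le> t" "\<And>u. u \<in> ?U \<Longrightarrow> t \<le> u"
    by (rule that[of "Sup ?L"])
  have "admissible G a t"
    unfolding admissible_def by (intro allI impI conjI t) blast+
  then show ?thesis ..
qed

text \<open>With \<open>a\<close> now on both sides, this makes assigning \<open>r + m t\<close> to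
  \<open>c + m a\<close> well defined and monotone. After cancellation the surplus of
  \<open>a\<close> decides what applies: the lower bounds for \<open>m < n\<close>, monotonicity of
  \<open>G\<close> for \<open>m = n\<close>, the upper bounds for \<open>n < m\<close>.\<close>

lemma admissible_le:
  fixes v a :: "'a::ordered_ab_semigroup_add"
  assumes v: "order_unit v" "(v, 1) \<in> G" and G: "state_graph G" and t: "admissible G a t"
    and c: "(c, r) \<in> G" "(c', r') \<in> G" and mn: "m \<ge> 1" "n \<ge> 1"
    and le: "c + multiple m a \<le> c' + multiple n a"
  shows "r + real m * t \<le> r' + real n * t"
proof -
  have "(multiple k v, real k) \<in> G" if "k \<ge> 1" for k
    using state_graph_multiple[OF G v(2) that] by simp
  note G_intros = this state_graph_add[OF G] state_graph_multiple[OF G]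
  consider "m < n" | "m = n" | "n < m" by linarith
  then show ?thesis
  proof cases
    case 1
    define d where "d = n - m"
    have d: "d \<ge> 1" "n = d + m" using 1 by (auto simp: d_def)
    have "c + multiple m a \<le> (c' + multiple d a) + multiple m a"
      using le d mn by (simp add: multiple_add add.assoc)
    then obtain N where N: "N \<ge> 1"
      "\<And>k. k \<ge> 1 \<Longrightarrow> multiple k c + v \<le> multiple k (c' + multiple d a) + multiple N v"
      using multiple_cancel_upto_order_unit[OF v(1)] by blast
    \<comment> \<open>The \<open>v\<close> on the left has value 1 and \<open>N v\<close> on the
      right has value \<open>N\<close>; hence the constant \<open>N - 1\<close>, the same for all
      \<open>k\<close>.\<close>
    have "real k * (r - r' - real d * t) \<le> real N - 1" if k: "k \<ge> 1" for k
    proof -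
      have "multiple k c + v \<le> (multiple k c' + multiple N v) + multiple (k * d) a"
        using N(2)[OF k] k d(1) by (simp add: multiple_plus_distrib multiple_multiple ac_simps)
      then have "(real k * r + 1) - (real k * r' + real N) \<le> real (k * d) * t"
        by (rule admissible_lower[OF t, rotated 3]) (use c v(2) k d(1) N(1) in \<open>auto intro!: G_intros\<close>)
      then show ?thesis by (simp add: algebra_simps)
    qed
    then have "r - r' - real d * t \<le> 0" by (rule nonpos_if_multiples_bounded)
    then show ?thesis using d(2) by (simp add: algebra_simps)
  next
    case 2
    then obtain N where N: "N \<ge> 1"
      "\<And>k. k \<ge> 1 \<Longrightarrow> multiple k c + v \<le> multiple k c' + multiple N v"
      using multiple_cancel_upto_order_unit[OF v(1)] le by blast
    have "real k * (r - r') \<le> real N - 1" if k: "k \<ge> 1" for k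
    proof -
      have "real k * r + 1 \<le> real k * r' + real N"
        using N(2)[OF k] by (rule state_graph_mono[OF G, rotated 2])
          (use c v(2) k N(1) in \<open>auto intro!: G_intros\<close>)
      then show ?thesis by (simp add: algebra_simps)
    qed
    then have "r - r' \<le> 0" by (rule nonpos_if_multiples_bounded)
    then show ?thesis using 2 by simp
  next
    case 3
    define d where "d = m - n"
    have d: "d \<ge> 1" "m = d + n" using 3 by (auto simp: d_def)
    have "(c + multiple d a) + multiple n a \<le> c' + multiple n a"
      using le d mn by (simp add: multiple_add add.assoc)
    then obtain N where N: "N \<ge> 1"
      "\<And>k. k \<ge> 1 \<Longrightarrow> multiple k (c + multiple d a) + v \<le> multiple k c' + multiple N v"
      using multiple_cancel_upto_order_unit[OF v(1)] by blast
    have "real k * (r - r' + real d * t) \<le> real N - 1" if k: "k \<ge> 1" for k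
    proof -
      have "(multiple k c + v) + multiple (k * d) a \<le> multiple k c' + multiple N v"
        using N(2)[OF k] k d(1) by (simp add: multiple_plus_distrib multiple_multiple ac_simps)
      then have "real (k * d) * t \<le> (real k * r' + real N) - (real k * r + 1)"
        by (rule admissible_upper[OF t, rotated 3]) (use c v(2) k d(1) N(1) in \<open>auto intro!: G_intros\<close>)
      then show ?thesis by (simp add: algebra_simps)
    qed
    then have "r - r' + real d * t \<le> 0" by (rule nonpos_if_multiples_bounded)
    then show ?thesis using d(2) by (simp add: algebra_simps)
  qed
qed

section \<open>Extension by one element, then to the whole semigroup\<close>

lemma state_graph_extend_one:
  fixes v a :: "'a::ordered_ab_semigroup_add"
  assumes v: "order_unit v" "(v, 1) \<in> G" and G: "state_graph G" and t: "admissible G a t"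
  obtains H where "state_graph H" "G \<subseteq> H" "(a, t) \<in> H"
proof -
  \<comment> \<open>All elements whose value is forced by \<open>G\<close> and \<open>(a, t)\<close>. A multiple of \<open>a\<close> is kept on both sides
    because there is no neutral element to stand for the case of no \<open>a\<close>.\<close>
  define P where "P z s x r n y r' m \<longleftrightarrow> (x, r) \<in> G \<and> (y, r') \<in> G \<and> n \<ge> 1 \<and> m \<ge> 1 \<and>
    z + x + multiple n a = y + multiple m a \<and> s + r + real n * t = r' + real m * t"
    for z s x r n y r' m
  define H where "H = {(z, s). \<exists>x r n y r' m. P z s x r n y r' m}"
  have HI: "(z, s) \<in> H" if "P z s x r n y r' m" for z s x r n y r' m
    using that unfolding H_def by blast
  have "(z + z', s + s') \<in> H \<and> (z \<le> z' \<longrightarrow> s \<le> s')" if zs: "(z, s) \<in> H" "(z', s') \<in> H" for z s z' s'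
  proof -
    obtain x r n y q m where 1: "(x, r) \<in> G" "(y, q) \<in> G" "n \<ge> 1" "m \<ge> 1"
      "z + x + multiple n a = y + multiple m a" "s + r + real n * t = q + real m * t"
      using zs(1) unfolding H_def P_def by blast
    obtain x' r' n' y' q' m' where 2: "(x', r') \<in> G" "(y', q') \<in> G" "n' \<ge> 1" "m' \<ge> 1"
      "z' + x' + multiple n' a = y' + multiple m' a" "s' + r' + real n' * t = q' + real m' * t"
      using zs(2) unfolding H_def P_def by blast
    have "(z + z') + (x + x') + multiple (n + n') a
        = (z + x + multiple n a) + (z' + x' + multiple n' a)"
      using 1(3) 2(3) by (simp add: multiple_add ac_simps)
    also have "\<dots> = (y + y') + multiple (m + m') a"
      unfolding 1(5) 2(5) using 1(4) 2(4) by (simp add: multiple_add ac_simps)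
    finally have "P (z + z') (s + s') (x + x') (r + r') (n + n') (y + y') (q + q') (m + m')"
      unfolding P_def using 1 2 by (auto intro: state_graph_add[OF G] simp: algebra_simps)
    then have sum: "(z + z', s + s') \<in> H" by (rule HI)
    moreover have "s \<le> s'" if "z \<le> z'"
    proof -
      \<comment> \<open>Adding \<open>x + n a + x' + n' a\<close> to both sides of
        \<open>z \<le> z'\<close> turns each side into an element of the form
        \<open>c + m a\<close>, to which \<open>admissible_le\<close> applies. The added values
        cancel in the reals.\<close>
      have "(y + x') + multiple (m + n') a = (y + multiple m a) + (x' + multiple n' a)"
        using 1(4) 2(3) by (simp add: multiple_add ac_simps)
      also have "\<dots> = z + (x + multiple n a + (x' + multiple n' a))"
        unfolding 1(5)[symmetric] by (simp add: ac_simps)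
      also have "\<dots> \<le> z' + (x + multiple n a + (x' + multiple n' a))"
        using that by (rule add_right_mono)
      also have "\<dots> = (z' + x' + multiple n' a) + (x + multiple n a)" by (simp add: ac_simps)
      also have "\<dots> = (y' + x) + multiple (m' + n) a"
        unfolding 2(5) using 2(4) 1(3) by (simp add: multiple_add ac_simps)
      finally have "(q + r') + real (m + n') * t \<le> (q' + r) + real (m' + n) * t"
        by (rule admissible_le[OF v G t, rotated 4])
          (use 1 2 in \<open>auto intro: state_graph_add[OF G]\<close>)
      then show ?thesis using 1(6) 2(6) by (simp add: algebra_simps)
    qed
    ultimately show ?thesis by blast
  qed
  then have "state_graph H" unfolding state_graph_def by blast
  moreover have "G \<subseteq> H"
  proof (rule subrelI)
    fix z s assume "(z, s) \<in> G"
    \<comment> \<open>The equation is \<open>z + v + a = (z + v) + a\<close>: padding by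
      \<open>v\<close>, of value 1, replaces the missing zero.\<close>
    then have "P z s v 1 1 (z + v) (s + 1) 1"
      unfolding P_def using v(2) by (auto intro: state_graph_add[OF G])
    then show "(z, s) \<in> H" by (rule HI)
  qed
  \<comment> \<open>The equation is \<open>a + v + a = v + 2 a\<close>.\<close>
  moreover have "P a t v 1 1 v 1 (1 + 1)"
    unfolding P_def using v(2) multiple_add[of 1 1 a] multiple_1[of a]
    by (simp add: ac_simps)
  then have "(a, t) \<in> H" by (rule HI)
  ultimately show ?thesis by (rule that)
qed

text \<open>In a graph maximal under inclusion every \<open>x\<close> already has a value: an
  admissible one exists, and the one-element extension by it contains the graph, hence equals
  it.\<close>

lemma state_graph_extend_total:
  fixes v :: "'a::ordered_ab_semigroup_add"
  assumes v: "order_unit v" "(v, 1) \<in> G" and G: "state_graph G"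
  obtains \<psi> where "state_on UNIV v \<psi>" "\<And>x r. (x, r) \<in> G \<Longrightarrow> \<psi> x = r"
proof -
  let ?A = "{H. state_graph H \<and> G \<subseteq> H}"
  have "\<exists>M\<in>?A. \<forall>H\<in>?A. M \<subseteq> H \<longrightarrow> H = M"
  proof (rule subset_Zorn_nonempty)
    show "?A \<noteq> {}" using G by blast
  next
    fix C assume "C \<noteq> {}" and C: "subset.chain ?A C"
    \<comment> \<open>Two pairs of the union lie in a common member of the chain, where sums and
      comparisons can be checked.\<close>
    have "(x + y, r + s) \<in> \<Union>C \<and> (x \<le> y \<longrightarrow> r \<le> s)"
      if xy: "(x, r) \<in> \<Union>C" "(y, s) \<in> \<Union>C" for x r y s
    proof -
      obtain H1 H2 where H: "H1 \<in> C" "(x, r) \<in> H1" "H2 \<in> C" "(y, s) \<in> H2" using xy by blast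
      then have "H1 \<subseteq> H2 \<or> H2 \<subseteq> H1" using C by (auto simp: subset_chain_def)
      then obtain H where "H \<in> C" "(x, r) \<in> H" "(y, s) \<in> H" using H by blast
      moreover from this have "state_graph H" using C by (auto simp: subset_chain_def)
      ultimately show ?thesis unfolding state_graph_def by blast
    qed
    then have "state_graph (\<Union>C)" unfolding state_graph_def by blast
    moreover have "G \<subseteq> \<Union>C" using C \<open>C \<noteq> {}\<close> by (fastforce simp: subset_chain_def)
    ultimately show "\<Union>C \<in> ?A" by blast
  qed
  then obtain M where M: "state_graph M" "G \<subseteq> M" and "\<forall>H\<in>?A. M \<subseteq> H \<longrightarrow> H = M" by blast
  then have max: "H = M" if "state_graph H" "M \<subseteq> H" for H using that by blast
  have vM: "(v, 1) \<in> M" using v(2) M(2) by blast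
  have "\<exists>t. (x, t) \<in> M" for x
  proof -
    obtain t where "admissible M x t" using admissible_exists[OF v(1) vM M(1)] by blast
    then obtain H where "state_graph H" "M \<subseteq> H" "(x, t) \<in> H"
      using state_graph_extend_one[OF v(1) vM M(1)] by blast
    then show ?thesis using max by blast
  qed
  then obtain \<psi> where \<psi>: "\<And>x. (x, \<psi> x) \<in> M" by metis
  have uniq: "\<psi> x = r" if "(x, r) \<in> M" for x r
    using state_graph_mono[OF M(1)] \<psi> that by (meson order_antisym order_refl)
  have "state_on UNIV v \<psi>"
    unfolding state_on_def
    using uniq[OF vM] uniq[OF state_graph_add[OF M(1) \<psi> \<psi>]] state_graph_mono[OF M(1) \<psi> \<psi>] by blast
  then show ?thesis using that uniq M(2) by blast
qed

section \<open>The values attained by extensions, and the theorem\<close>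

lemma state_extends_iff_admissible:
  fixes v a :: "'a::ordered_ab_semigroup_add"
  assumes v: "order_unit v" "v \<in> S" and S: "subsemigroup S" "state_on S v f"
  shows "(\<exists>\<psi>. state_on UNIV v \<psi> \<and> extends_on S f \<psi> \<and> \<psi> a = t)
    \<longleftrightarrow> admissible {(x, f x) | x. x \<in> S} a t" (is "?L \<longleftrightarrow> admissible ?G a t")
proof
  assume ?L
  then obtain \<psi> where \<psi>: "state_on UNIV v \<psi>" "extends_on S f \<psi>" "\<psi> a = t" by blast
  have "state_graph {(x, \<psi> x) | x. x \<in> UNIV}"
    using \<psi>(1) by (intro state_graph_of_state_on) (auto simp: subsemigroup_def)
  then show "admissible ?G a t"
    by (rule admissible_if_state_graph) (use \<psi>(2,3) in \<open>auto simp: extends_on_def\<close>)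
next
  assume t: "admissible ?G a t"
  have G: "state_graph ?G" using S by (rule state_graph_of_state_on)
  have vG: "(v, 1) \<in> ?G" using v(2) S(2) by (auto simp: state_on_def)
  \<comment> \<open>The pair \<open>(a, t)\<close> is adjoined before the extension to the whole
    semigroup, which therefore keeps the value \<open>t\<close> at \<open>a\<close>.\<close>
  obtain H where H: "state_graph H" "?G \<subseteq> H" "(a, t) \<in> H"
    using state_graph_extend_one[OF v(1) vG G t] by blast
  then have "(v, 1) \<in> H" using vG by blast
  then obtain \<psi> where \<psi>: "state_on UNIV v \<psi>" "\<And>x r. (x, r) \<in> H \<Longrightarrow> \<psi> x = r"
    using state_graph_extend_total[OF v(1) _ H(1)] by blast
  moreover have "extends_on S f \<psi>" unfolding extends_on_def using \<psi>(2) H(2) by blast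
  moreover have "\<psi> a = t" using \<psi>(2) H(3) by blast
  ultimately show ?L by blast
qed

lemma state_extends:
  fixes v :: "'a::ordered_ab_semigroup_add"
  assumes v: "order_unit v" "v \<in> S" and S: "subsemigroup S" "state_on S v f"
  shows "\<exists>\<psi>. state_on UNIV v \<psi> \<and> extends_on S f \<psi>"
proof -
  have "(v, 1) \<in> {(x, f x) | x. x \<in> S}" using v(2) S(2) by (auto simp: state_on_def)
  \<comment> \<open>Only some extension is wanted, so the element whose value is prescribed may be
    chosen freely; \<open>v\<close> is taken.\<close>
  then obtain t where "admissible {(x, f x) | x. x \<in> S} v t"
    using admissible_exists[OF v(1) _ state_graph_of_state_on[OF S]] by blast
  then show ?thesis using state_extends_iff_admissible[OF assms, of v t] by blast
qed

theorem theoremA2: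
  fixes v a :: "'a::ordered_ab_semigroup_add"
    and W\<^sub>1 :: "'a set"
    and \<phi> :: "'a \<Rightarrow> real"
    and p q :: ereal
  assumes "order_unit v"
    and "subsemigroup W\<^sub>1"
    and "v \<in> W\<^sub>1"
    and "state_on W\<^sub>1 v \<phi>"
    and "p = Sup {ereal ((\<phi> b - \<phi> c) / real m) | b c m.
                    b \<in> W\<^sub>1 \<and> c \<in> W\<^sub>1 \<and> m \<ge> 1 \<and> b \<le> c + multiple m a}"
    and "q = Inf {ereal ((\<phi> b - \<phi> c) / real m) | b c m.
                    b \<in> W\<^sub>1 \<and> c \<in> W\<^sub>1 \<and> m \<ge> 1 \<and> b \<ge> c + multiple m a}"
  shows "- \<infinity> < p \<and> p \<le> q \<and> q < \<infinity>
    \<and> {p..q} = {ereal (\<psi> a) | \<psi>. state_on UNIV v \<psi> \<and> extends_on W\<^sub>1 \<phi> \<psi>}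
    \<and> (\<forall>\<phi>'. state_on W\<^sub>1 v \<phi>' \<longrightarrow> (\<exists>\<psi>. state_on UNIV v \<psi> \<and> extends_on W\<^sub>1 \<phi>' \<psi>))"
proof -
  note ext_iff = state_extends_iff_admissible[OF assms(1,3,2,4), of a]
  have adm_iff: "admissible {(x, \<phi> x) | x. x \<in> W\<^sub>1} a t \<longleftrightarrow> p \<le> ereal t \<and> ereal t \<le> q" for t
  proof -
    \<comment> \<open>In the complete lattice \<open>ereal\<close>, comparing with
      \<open>Sup\<close> or \<open>Inf\<close> amounts to comparing with every member.\<close>
    have "p \<le> ereal t \<longleftrightarrow> (\<forall>b c m. b \<in> W\<^sub>1 \<longrightarrow> c \<in> W\<^sub>1 \<longrightarrow> m \<ge> 1 \<longrightarrow>
        b \<le> c + multiple m a \<longrightarrow> ereal ((\<phi> b - \<phi> c) / real m) \<le> ereal t)"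
      unfolding assms(5) Sup_le_iff by blast
    moreover have "ereal t \<le> q \<longleftrightarrow> (\<forall>b c m. b \<in> W\<^sub>1 \<longrightarrow> c \<in> W\<^sub>1 \<longrightarrow> m \<ge> 1 \<longrightarrow>
        c + multiple m a \<le> b \<longrightarrow> ereal t \<le> ereal ((\<phi> b - \<phi> c) / real m))"
      unfolding assms(6) le_Inf_iff by blast
    ultimately show ?thesis unfolding admissible_iff_state_on ereal_less_eq by blast
  qed
  obtain n where n: "n \<ge> 1" "a \<le> multiple n v" "v \<le> a + multiple n v"
    using assms(1) unfolding order_unit_def by blast
  have nv: "multiple n v \<in> W\<^sub>1"
    using n(1)
  proof (induction n rule: nat_induct_at_least)
    case base
    show ?case using assms(3) by simp
  next
    case (Suc n)
    then show ?case using assms(2,3) by (simp add: multiple_Suc subsemigroup_def)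
  qed
  then have v_nv: "v + multiple n v \<in> W\<^sub>1" using assms(2,3) unfolding subsemigroup_def by blast
  \<comment> \<open>One real member of each set settles finiteness:
    \<open>\<phi> v - \<phi> (n v)\<close> lies below \<open>p\<close>, and
    \<open>\<phi> (v + n v) - \<phi> v\<close> lies above \<open>q\<close>.\<close>
  have "v \<le> multiple n v + multiple 1 a" using n(3) by (simp only: multiple_1 add.commute)
  then have "ereal ((\<phi> v - \<phi> (multiple n v)) / real 1) \<le> p"
    unfolding assms(5) using assms(3) nv by (intro Sup_upper) blast
  then have p: "- \<infinity> < p" by (rule less_le_trans[rotated]) simp
  have "v + multiple n v \<ge> v + multiple 1 a" using n(2) by (simp only: multiple_1 add_left_mono)
  then have "q \<le> ereal ((\<phi> (v + multiple n v) - \<phi> v) / real 1)"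
    unfolding assms(6) using assms(3) v_nv by (intro Inf_lower) blast
  then have q: "q < \<infinity>" by (rule le_less_trans) simp
  \<comment> \<open>The value at \<open>a\<close> of a single extension lies between
    \<open>p\<close> and \<open>q\<close>, which gives \<open>p \<le> q\<close>.\<close>
  obtain \<psi> where "state_on UNIV v \<psi>" "extends_on W\<^sub>1 \<phi> \<psi>"
    using state_extends[OF assms(1,3,2,4)] by blast
  then have "p \<le> ereal (\<psi> a) \<and> ereal (\<psi> a) \<le> q" using ext_iff adm_iff by blast
  then have pq: "p \<le> q" using order_trans by blast
  \<comment> \<open>Since \<open>p\<close> is not \<open>-\<infinity>\<close> and \<open>q\<close>
    is not \<open>\<infinity>\<close>, the interval consists of real numbers only.\<close>
  have "{p..q} = {ereal t | t. p \<le> ereal t \<and> ereal t \<le> q}"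
  proof (intro subset_antisym subsetI)
    fix x assume x: "x \<in> {p..q}"
    then have "x \<noteq> - \<infinity>" "x \<noteq> \<infinity>" using p q by auto
    then obtain t where "x = ereal t" by (cases x) auto
    then show "x \<in> {ereal t | t. p \<le> ereal t \<and> ereal t \<le> q}" using x by auto
  qed auto
  also have "\<dots> = {ereal (\<psi> a) | \<psi>. state_on UNIV v \<psi> \<and> extends_on W\<^sub>1 \<phi> \<psi>}"
    unfolding adm_iff[symmetric] ext_iff[symmetric] by blast
  finally show ?thesis using p q pq state_extends[OF assms(1,3,2)] by blast
qed

end
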